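(* For all integers $m,n\ge 1$, the Alon--Tarsi number of the toroidal grid $T_{2m+1,2n+1}=C_{2m+1}\Box C_{2n+1}$ equals $4$.
   Context: For a graph $G$ with vertices $1,\ldots,n$, its graph polynomial is $f_G(x_1,\ldots,x_n)=\prod_{1\le i<j\le n,\ ij\in E(G)}(x_i-x_j)$. $G$ is Alon--Tarsi $k$-choosable if the expansion of $f_G$ (over $\mathbb{R}$) contains a monomial $c\prod_i x_i^{t_i}$ with $c\ne 0$ and $t_i\le k-1$ for all $i$; the Alon--Tarsi number $AT(G)$ is the smallest such $k$. $C_k$ is the cycle on $k$ vertices and $\Box$ is the Cartesian product of graphs; $T_{a,b}=C_a\Box C_b$. *)

theory Defs
  imports Complex_Main "HOL-Library.Poly_Mapping" "Graph_Theory.Pair_Digraph"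
begin

text \<open>
  A simple graph is a symmetric loop-free pair digraph (locale \<open>pair_graph\<close>), so each edge
  \<open>uv\<close> occurs as the two arcs \<open>(u, v)\<close> and \<open>(v, u)\<close>.
  A real polynomial with variables indexed by \<open>'v\<close> is an element of
  \<open>('v \<Rightarrow>\<^sub>0 nat) \<Rightarrow>\<^sub>0 real\<close>: it maps each exponent vector to the coefficient of its monomial.
\<close>

type_synonym 'v rpoly = "('v \<Rightarrow>\<^sub>0 nat) \<Rightarrow>\<^sub>0 real"

definition rvar :: "'v \<Rightarrow> 'v rpoly" where
  "rvar v = Poly_Mapping.single (Poly_Mapping.single v 1) 1"

definition numbering :: "'v pair_pre_digraph \<Rightarrow> ('v \<Rightarrow> nat) \<Rightarrow> bool" where
  "numbering G \<nu> \<longleftrightarrow> bij_betw \<nu> (pverts G) {1..card (pverts G)}"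

text \<open>
  The numbering \<open>\<nu>\<close> makes the vertices \<open>1, \<dots>, n\<close>; the variable \<open>x\<^sub>i\<close> is \<open>rvar v\<close> with \<open>\<nu> v = i\<close>,
  and selecting the arcs with increasing numbers counts every edge once.
\<close>

definition graph_poly :: "('v \<Rightarrow> nat) \<Rightarrow> 'v pair_pre_digraph \<Rightarrow> 'v rpoly" where
  "graph_poly \<nu> G = (\<Prod>(u, v) \<in> {(u, v) \<in> parcs G. \<nu> u < \<nu> v}. rvar u - rvar v)"

text \<open>The choice of \<open>\<nu>\<close> below is immaterial, see \<open>alon_tarsi_choosable_iff\<close>.\<close>

definition alon_tarsi_choosable :: "'v pair_pre_digraph \<Rightarrow> nat \<Rightarrow> bool" where
  "alon_tarsi_choosable G k \<longleftrightarrow>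
     (\<exists>\<nu>. numbering G \<nu> \<and>
       (\<exists>t. Poly_Mapping.lookup (graph_poly \<nu> G) t \<noteq> 0 \<and>
            (\<forall>v \<in> pverts G. Poly_Mapping.lookup t v < k)))"

definition alon_tarsi_number :: "'v pair_pre_digraph \<Rightarrow> nat" where
  "alon_tarsi_number G = (LEAST k. alon_tarsi_choosable G k)"

text \<open>The intended range is \<open>k \<ge> 3\<close>; smaller \<open>k\<close> give degenerate graphs.\<close>

definition cycle_graph :: "nat \<Rightarrow> nat pair_pre_digraph" where
  "cycle_graph k = \<lparr> pverts = {..<k},
     parcs = {(i, j). i < k \<and> j < k \<and> (j = (i + 1) mod k \<or> i = (j + 1) mod k)} \<rparr>"

definition box_product ::
  "'a pair_pre_digraph \<Rightarrow> 'b pair_pre_digraph \<Rightarrow> ('a \<times> 'b) pair_pre_digraph"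
  (infixr \<open>\<box>\<close> 80) where
  "G \<box> H = \<lparr> pverts = pverts G \<times> pverts H,
     parcs = {((u, v), (u', v')).
       (u = u' \<and> u \<in> pverts G \<and> (v, v') \<in> parcs H) \<or>
       (v = v' \<and> v \<in> pverts H \<and> (u, u') \<in> parcs G)} \<rparr>"

definition toroidal_grid :: "nat \<Rightarrow> nat \<Rightarrow> (nat \<times> nat) pair_pre_digraph" where
  "toroidal_grid a b = cycle_graph a \<box> cycle_graph b"

lemma pair_graph_cycle_graph:
  assumes "k \<ge> 2"
  shows "pair_graph (cycle_graph k)"
proof
  have "parcs (cycle_graph k) \<subseteq> {..<k} \<times> {..<k}"
    by (auto simp: cycle_graph_def)
  then show "finite (parcs (cycle_graph k))"
    by (rule finite_subset) simp
next
  have "sym (parcs (cycle_graph k))"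
    by (auto simp: cycle_graph_def sym_def)
  then show "symmetric (with_proj (cycle_graph k))"
    by (simp add: symmetric_def arcs_ends_def arc_to_ends_def with_proj_def)
qed (use assms in \<open>auto simp: cycle_graph_def mod_Suc split: if_splits\<close>)

lemma pair_graph_box_product:
  assumes "pair_graph G" "pair_graph H"
  shows "pair_graph (G \<box> H)"
proof -
  interpret G: pair_graph G by fact
  interpret H: pair_graph H by fact
  show ?thesis
  proof
    show arc_fst: "fst e \<in> pverts (G \<box> H)" if "e \<in> parcs (G \<box> H)" for e
      using that G.arc_fst_in_verts H.arc_fst_in_verts by (force simp: box_product_def)
    show arc_snd: "snd e \<in> pverts (G \<box> H)" if "e \<in> parcs (G \<box> H)" for e
      using that G.arc_snd_in_verts H.arc_snd_in_verts by (force simp: box_product_def)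
    show fin: "finite (pverts (G \<box> H))"
      by (simp add: box_product_def G.pair_finite_verts H.pair_finite_verts)
    have "parcs (G \<box> H) \<subseteq> pverts (G \<box> H) \<times> pverts (G \<box> H)"
      using arc_fst arc_snd by (metis mem_Times_iff subsetI)
    then show "finite (parcs (G \<box> H))"
      using fin finite_subset by blast
    show "fst e \<noteq> snd e" if "e \<in> parcs (G \<box> H)" for e
      using that G.pair_no_loops H.pair_no_loops by (force simp: box_product_def)
    have "sym (parcs G)" "sym (parcs H)"
      using G.pair_sym_arcs H.pair_sym_arcs
      by (simp_all add: symmetric_def)
    then have "sym (parcs (G \<box> H))"
      by (auto simp: box_product_def sym_def)
    then show "symmetric (with_proj (G \<box> H))"
      by (simp add: symmetric_def arcs_ends_def arc_to_ends_def with_proj_def)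
  qed
qed

lemma graph_poly_renumber:
  assumes "pair_graph G" and \<mu>: "numbering G \<mu>" and \<nu>: "numbering G \<nu>"
  shows "graph_poly \<mu> G = graph_poly \<nu> G \<or> graph_poly \<mu> G = - graph_poly \<nu> G"
proof -
  interpret pair_graph G by fact
  have sym: "(v, u) \<in> parcs G" if "(u, v) \<in> parcs G" for u v
    using pair_sym_arcs that by (auto simp: symmetric_def sym_def)
  have V: "u \<in> pverts G" "v \<in> pverts G" "u \<noteq> v" if "(u, v) \<in> parcs G" for u v
    using arc_fst_in_verts[OF that] arc_snd_in_verts[OF that] pair_no_loops[OF that] by auto
  have inj: "inj_on \<mu> (pverts G)" "inj_on \<nu> (pverts G)"
    using \<mu> \<nu> by (auto simp: numbering_def bij_betw_def)
  have ne: "\<mu> u \<noteq> \<mu> v" "\<nu> u \<noteq> \<nu> v" if "(u, v) \<in> parcs G" for u v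
    using V[OF that] inj by (auto dest: inj_onD)
  define A where "A = {(u, v) \<in> parcs G. \<mu> u < \<mu> v}"
  define B where "B = {(u, v) \<in> parcs G. \<nu> u < \<nu> v}"
  define h where "h = (\<lambda>(u, v). if \<nu> u < \<nu> v then (u, v) else (v, u))"
  have "finite A"
    unfolding A_def by (rule finite_subset[OF _ pair_finite_arcs]) auto
  have "inj_on h A"
    by (auto simp: inj_on_def A_def h_def split: if_splits)
  moreover have "h ` A = B"
  proof
    show "h ` A \<subseteq> B"
    proof
      fix x assume "x \<in> h ` A"
      then obtain u v where uv: "(u, v) \<in> parcs G" "x = h (u, v)"
        by (auto simp: A_def)
      show "x \<in> B" using uv sym[OF uv(1)] ne(2)[OF uv(1)] by (auto simp: B_def h_def)
    qed
    show "B \<subseteq> h ` A"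
    proof
      fix x assume "x \<in> B"
      then obtain u v where x: "x = (u, v)" "(u, v) \<in> parcs G" "\<nu> u < \<nu> v" by (auto simp: B_def)
      show "x \<in> h ` A"
      proof (cases "\<mu> u < \<mu> v")
        case True
        then show ?thesis using x by (auto simp: A_def h_def intro!: image_eqI[of _ _ "(u, v)"])
      next
        case False
        then have "(v, u) \<in> A" using x sym ne[OF x(2)] by (auto simp: A_def)
        moreover have "x = h (v, u)" using x by (auto simp: h_def)
        ultimately show ?thesis by blast
      qed
    qed
  qed
  ultimately have nu: "graph_poly \<nu> G = (\<Prod>(u, v) \<in> A. case h (u, v) of (u, v) \<Rightarrow> rvar u - rvar v)"
    unfolding graph_poly_def B_def[symmetric] by (subst prod.reindex_cong[of h A]) auto
  have "(\<Prod>(u, v) \<in> S. rvar u - rvar v :: 'a rpoly)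
      = (\<Prod>(u, v) \<in> S. case h (u, v) of (u, v) \<Rightarrow> rvar u - rvar v) \<or>
    (\<Prod>(u, v) \<in> S. rvar u - rvar v :: 'a rpoly)
      = - (\<Prod>(u, v) \<in> S. case h (u, v) of (u, v) \<Rightarrow> rvar u - rvar v)" if "finite S" for S
    using that
  proof (induction S rule: finite_induct)
    case empty
    then show ?case by simp
  next
    case (insert e S)
    obtain u v where e: "e = (u, v)" by force
    define d where "d = (rvar u - rvar v :: 'a rpoly)"
    have d: "(case e of (u, v) \<Rightarrow> rvar u - rvar v) = d"
      by (simp add: e d_def)
    have "(case e of (u, v) \<Rightarrow> case h (u, v) of (u, v) \<Rightarrow> rvar u - rvar v) \<in> {d, - d}"
      by (simp add: e h_def d_def)
    then show ?case
      unfolding prod.insert[OF insert.hyps] d using insert.IH by auto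
  qed
  from this[OF \<open>finite A\<close>] show ?thesis
    unfolding nu by (simp add: graph_poly_def A_def)
qed

lemma alon_tarsi_choosable_iff:
  assumes "pair_graph G" "numbering G \<nu>"
  shows "alon_tarsi_choosable G k \<longleftrightarrow>
    (\<exists>t. Poly_Mapping.lookup (graph_poly \<nu> G) t \<noteq> 0 \<and>
         (\<forall>v \<in> pverts G. Poly_Mapping.lookup t v < k))"
proof -
  have "Poly_Mapping.lookup (graph_poly \<mu> G) t \<noteq> 0 \<longleftrightarrow>
      Poly_Mapping.lookup (graph_poly \<nu> G) t \<noteq> 0" if "numbering G \<mu>" for \<mu> t
    using graph_poly_renumber[OF assms(1) that assms(2)] by (auto simp: lookup_uminus)
  then show ?thesis
    unfolding alon_tarsi_choosable_def using assms(2) by blast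
qed

end

theory Submission
  imports Defs
begin

text \<open>
  The coefficient of a monomial in \<open>\<Prod>(x\<^sub>u - x\<^sub>v)\<close> is the signed number of ways to flip
  arcs so that the out-degrees become the exponents. With \<open>2ab\<close> edges on \<open>ab\<close> vertices, a monomial
  with exponents below 3 has all exponents equal to 2. It is invariant under the reflection of the
  first cycle, which reverses exactly the \<open>ab\<close> edges of the first direction; if \<open>a\<close> and \<open>b\<close> are odd,
  this negates its coefficient, which is therefore 0. Conversely, orient one 4-cycle of the grid
  cyclically and every other edge away from it, along increasing rank. Then every vertex has an
  incoming arc, so the out-degrees are at most 3, and all out-degree preserving flips live on the
  4-cycle and have even size, so the coefficient is positive.
\<close>

section \<open>Coefficients of products over arcs\<close>

text \<open>Any arc set is allowed, so that orientations containing directed cycles, which no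
  numbering induces, are covered too.\<close>

definition arc_prod :: "('v \<times> 'v) set \<Rightarrow> 'v rpoly" where
  "arc_prod A = (\<Prod>(u, v) \<in> A. rvar u - rvar v)"

text \<open>Expanding the product picks \<open>x_u\<close> or \<open>-x_v\<close> from each factor;
  \<open>S\<close>, taken inside \<open>A\<close>, holds the arcs where \<open>-x_v\<close> is
  picked. The result is the out-degree vector of \<open>A\<close> with \<open>S\<close>
  reversed.\<close>

definition flip_exp :: "('v \<times> 'v) set \<Rightarrow> ('v \<times> 'v) set \<Rightarrow> 'v \<Rightarrow>\<^sub>0 nat" where
  "flip_exp A S = (\<Sum>e\<in>S. Poly_Mapping.single (snd e) 1) + (\<Sum>e\<in>A - S. Poly_Mapping.single (fst e) 1)"

definition orients :: "('v \<times> 'v) set \<Rightarrow> ('v \<times> 'v) set \<Rightarrow> bool" where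
  "orients A R \<longleftrightarrow> A \<union> A\<inverse> = R \<and> A \<inter> A\<inverse> = {}"

lemma prod_rvar:
  "(\<Prod>e\<in>S. rvar (f e)) = Poly_Mapping.single (\<Sum>e\<in>S. Poly_Mapping.single (f e) 1) 1"
  by (induction S rule: infinite_finite_induct) (simp_all add: rvar_def mult_single)

lemma lookup_minus_one_power_mult:
  fixes p :: "'v rpoly"
  shows "Poly_Mapping.lookup ((- 1) ^ c * p) t = (- 1) ^ c * Poly_Mapping.lookup p t"
  by (cases "even c") (simp_all add: lookup_uminus)

lemma lookup_arc_prod:
  assumes "finite A"
  shows "Poly_Mapping.lookup (arc_prod A) t = (\<Sum>S | S \<subseteq> A \<and> flip_exp A S = t. (- 1) ^ card S)"
proof -
  have "arc_prod A = (\<Prod>e\<in>A. rvar (fst e) - rvar (snd e))"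
    by (simp add: arc_prod_def case_prod_unfold)
  also have "\<dots> = (\<Sum>S\<in>Pow A. (- 1) ^ card S * Poly_Mapping.single (flip_exp A S) 1)"
    by (simp add: prod_diff_conv_sum[OF assms] prod_rvar mult.assoc mult_single flip_exp_def)
  finally have "Poly_Mapping.lookup (arc_prod A) t
      = (\<Sum>S\<in>Pow A. (- 1) ^ card S * (1 when flip_exp A S = t))"
    by (simp add: lookup_sum lookup_minus_one_power_mult lookup_single)
  also have "\<dots> = (\<Sum>S\<in>Pow A. if flip_exp A S = t then (- 1) ^ card S else 0)"
    by (rule sum.cong) (auto simp: when_def)
  also have "\<dots> = (\<Sum>S | S \<subseteq> A \<and> flip_exp A S = t. (- 1) ^ card S)"
    using assms by (simp add: sum.inter_filter[symmetric] Pow_def)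
  finally show ?thesis .
qed

text \<open>Each reversed arc negates its factor; disjointness lets both products split.\<close>

lemma arc_prod_converse_union:
  assumes "finite H" "finite W" "H \<inter> W = {}" "H\<inverse> \<inter> W = {}"
  shows "arc_prod (H\<inverse> \<union> W) = (- 1) ^ card H * arc_prod (H \<union> W)"
proof -
  have "arc_prod (H\<inverse>) = (\<Prod>e\<in>H. rvar (snd e) - rvar (fst e))"
    unfolding arc_prod_def case_prod_unfold
    by (rule prod.reindex_bij_witness[of _ "\<lambda>(u, v). (v, u)" "\<lambda>(u, v). (v, u)"]) auto
  also have "\<dots> = (- 1) ^ card H * arc_prod H"
    unfolding arc_prod_def case_prod_unfold by (rule prod_diff_swap)
  finally show ?thesis
    using assms by (simp add: arc_prod_def prod.union_disjoint mult.assoc)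
qed

text \<open>\<open>B\<close> arises from \<open>A\<close> by reversing \<open>A - B\<close>, so the
  two products differ at most by a sign.\<close>

lemma lookup_arc_prod_orients:
  assumes "finite R" "orients A R" "orients B R"
  shows "Poly_Mapping.lookup (arc_prod A) t \<noteq> 0 \<longleftrightarrow> Poly_Mapping.lookup (arc_prod B) t \<noteq> 0"
proof -
  have "finite A"
    using assms finite_subset[of A R] by (auto simp: orients_def)
  moreover have "A - B \<union> A \<inter> B = A" "(A - B)\<inverse> \<union> A \<inter> B = B"
    using assms unfolding orients_def by blast+
  moreover have "(A - B)\<inverse> \<inter> (A \<inter> B) = {}"
    using assms unfolding orients_def by blast
  ultimately have "arc_prod B = (- 1) ^ card (A - B) * arc_prod A"
    using arc_prod_converse_union[of "A - B" "A \<inter> B"] by auto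
  then show ?thesis
    by (simp add: lookup_minus_one_power_mult)
qed

text \<open>Frees the criterion from numberings: every orientation yields the graph polynomial up to
  sign.\<close>

lemma alon_tarsi_choosable_orients:
  assumes "pair_graph G" "orients A (parcs G)"
  shows "alon_tarsi_choosable G k \<longleftrightarrow>
    (\<exists>t. Poly_Mapping.lookup (arc_prod A) t \<noteq> 0 \<and> (\<forall>v \<in> pverts G. Poly_Mapping.lookup t v < k))"
proof -
  interpret pair_graph G by fact
  obtain \<nu> where \<nu>: "numbering G \<nu>"
    using finite_same_card_bij[of "pverts G" "{1..card (pverts G)}"] pair_finite_verts
    by (auto simp: numbering_def)
  define B where "B = {(u, v) \<in> parcs G. \<nu> u < \<nu> v}"
  have "sym (parcs G)"
    using pair_sym_arcs by (simp add: symmetric_def)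
  moreover have "\<nu> u \<noteq> \<nu> v" if "(u, v) \<in> parcs G" for u v
    using \<nu> arc_fst_in_verts[OF that] arc_snd_in_verts[OF that] pair_no_loops[OF that]
    by (auto simp: numbering_def bij_betw_def dest: inj_onD)
  ultimately have "orients B (parcs G)"
    by (fastforce simp: orients_def B_def sym_def)
  then have "Poly_Mapping.lookup (arc_prod B) t \<noteq> 0 \<longleftrightarrow> Poly_Mapping.lookup (arc_prod A) t \<noteq> 0" for t
    using assms(2) pair_finite_arcs lookup_arc_prod_orients by blast
  moreover have "graph_poly \<nu> G = arc_prod B"
    by (simp add: graph_poly_def arc_prod_def B_def)
  ultimately show ?thesis
    using alon_tarsi_choosable_iff[OF assms(1) \<nu>] by simp
qed

section \<open>Weighted out-degree sums and flips\<close>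

lemma weighted_sum_lookup:
  fixes \<phi> :: "'v \<Rightarrow> nat"
  assumes "finite V" "f ` S \<subseteq> V"
  shows "(\<Sum>v\<in>V. \<phi> v * Poly_Mapping.lookup (\<Sum>e\<in>S. Poly_Mapping.single (f e) 1) v) = (\<Sum>e\<in>S. \<phi> (f e))"
proof -
  have "(\<Sum>v\<in>V. \<phi> v * Poly_Mapping.lookup (\<Sum>e\<in>S. Poly_Mapping.single (f e) 1) v)
      = (\<Sum>e\<in>S. \<Sum>v\<in>V. \<phi> v * (1 when f e = v))"
    by (simp add: lookup_sum sum_distrib_left lookup_single sum.swap[of _ S])
  also have "\<dots> = (\<Sum>e\<in>S. \<Sum>v\<in>V. if v = f e then \<phi> v else 0)"
    by (intro sum.cong) (auto simp: when_def)
  also have "\<dots> = (\<Sum>e\<in>S. \<phi> (f e))"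
    using assms by (intro sum.cong) (auto simp: sum.delta)
  finally show ?thesis .
qed

text \<open>Double counting: \<open>v\<close> is weighted once for each arc whose tail after the
  flips is \<open>v\<close>.\<close>

lemma flip_exp_weighted_sum:
  fixes \<phi> :: "'v \<Rightarrow> nat"
  assumes "finite V" "A \<subseteq> V \<times> V" "S \<subseteq> A"
  shows "(\<Sum>v\<in>V. \<phi> v * Poly_Mapping.lookup (flip_exp A S) v)
    = (\<Sum>e\<in>S. \<phi> (snd e)) + (\<Sum>e\<in>A - S. \<phi> (fst e))"
proof -
  have "snd ` S \<subseteq> V" "fst ` (A - S) \<subseteq> V"
    using assms by auto
  then show ?thesis
    using weighted_sum_lookup[of V snd S \<phi>] weighted_sum_lookup[of V fst "A - S" \<phi>] assms(1)
    by (simp add: flip_exp_def lookup_add distrib_left sum.distrib)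
qed

lemma flip_exp_outside:
  assumes "A \<subseteq> V \<times> V" "S \<subseteq> A" "v \<notin> V"
  shows "Poly_Mapping.lookup (flip_exp A S) v = 0"
proof -
  have "snd e \<noteq> v" "fst e \<noteq> v" if "e \<in> A" for e
    using that assms by auto
  then show ?thesis
    using assms(2) by (auto simp: flip_exp_def lookup_add lookup_sum lookup_single when_def intro!: sum.neutral)
qed

text \<open>
  Flipping a set \<open>S\<close> of arcs that keeps all out-degrees preserves the sum over the tails of every
  weight. The weight \<open>r\<close> confines \<open>S\<close> to arcs inside the level sets of \<open>r\<close>, and there the
  weight \<open>p\<close>, a 2-colouring, shows that \<open>S\<close> has even size. So no cancellation occurs.
\<close>

lemma lookup_arc_prod_outdegrees_nonzero:
  fixes r p :: "'v \<Rightarrow> nat"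
  assumes "finite A"
    and r: "\<And>u v. (u, v) \<in> A \<Longrightarrow> r u \<le> r v"
    and p: "\<And>u v. (u, v) \<in> A \<Longrightarrow> r u = r v \<Longrightarrow> p u + p v = 1"
  shows "Poly_Mapping.lookup (arc_prod A) (flip_exp A {}) \<noteq> 0"
proof -
  let ?F = "{S. S \<subseteq> A \<and> flip_exp A S = flip_exp A {}}"
  have even_flip: "even (card S)" if "S \<in> ?F" for S
  proof -
    have S: "S \<subseteq> A" "flip_exp A S = flip_exp A {}"
      using that by auto
    define V where "V = fst ` A \<union> snd ` A"
    have V: "finite V" "A \<subseteq> V \<times> V"
      using \<open>finite A\<close> by (force simp: V_def)+
    have balanced: "(\<Sum>e\<in>S. \<phi> (snd e)) = (\<Sum>e\<in>S. \<phi> (fst e))" for \<phi> :: "'v \<Rightarrow> nat"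
      using flip_exp_weighted_sum[OF V S(1), of \<phi>] flip_exp_weighted_sum[OF V, of "{}" \<phi>] S
        sum.subset_diff[OF S(1) \<open>finite A\<close>, of "\<lambda>e. \<phi> (fst e)"]
      by simp
    have "finite S"
      using S(1) \<open>finite A\<close> by (rule finite_subset)
    \<comment> \<open>No tail term exceeds its head term, so equal sums force equality term by
      term.\<close>
    have level: "r (fst e) = r (snd e)" if "e \<in> S" for e
      by (rule sum_mono_inv[where f = "\<lambda>e. r (fst e)" and g = "\<lambda>e. r (snd e)"])
        (use that S r balanced[of r] \<open>finite S\<close> in auto)
    have "p (fst e) + p (snd e) = 1" if "e \<in> S" for e
      using p[of "fst e" "snd e"] level[OF that] S(1) that by auto
    then have "card S = (\<Sum>e\<in>S. p (fst e) + p (snd e))"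
      by simp
    also have "\<dots> = 2 * (\<Sum>e\<in>S. p (fst e))"
      using balanced[of p] by (simp add: sum.distrib)
    finally show ?thesis
      by simp
  qed
  have "Poly_Mapping.lookup (arc_prod A) (flip_exp A {}) = (\<Sum>S\<in>?F. (- 1) ^ card S)"
    by (rule lookup_arc_prod[OF \<open>finite A\<close>])
  also have "\<dots> = (\<Sum>S\<in>?F. 1)"
    by (rule sum.cong) (simp_all add: even_flip)
  also have "\<dots> = real (card ?F)"
    by simp
  \<comment> \<open>The empty flip set lies in \<open>?F\<close>, so the count is positive.\<close>
  finally show ?thesis
    using \<open>finite A\<close> by (auto simp: card_gt_0_iff)
qed

text \<open>Taking images under \<open>\<rho>\<close> matches the flip sets of both arc sets, keeps
  their sizes and permutes the exponents; as \<open>t\<close> is invariant, the signed counts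
  agree.\<close>

lemma lookup_arc_prod_image:
  assumes "bij \<rho>" "finite A" and t: "\<And>v. Poly_Mapping.lookup t (\<rho> v) = Poly_Mapping.lookup t v"
  shows "Poly_Mapping.lookup (arc_prod (map_prod \<rho> \<rho> ` A)) t = Poly_Mapping.lookup (arc_prod A) t"
proof -
  define h where "h = map_prod \<rho> \<rho>"
  have "inj \<rho>" "surj \<rho>"
    using \<open>bij \<rho>\<close> by (auto simp: bij_def)
  then have "inj h"
    by (simp add: h_def prod.inj_map)
  have flip: "Poly_Mapping.lookup (flip_exp (h ` A) (h ` S)) (\<rho> v)
      = Poly_Mapping.lookup (flip_exp A S) v" for S v
    using \<open>inj h\<close> \<open>inj \<rho>\<close>
    by (simp add: flip_exp_def lookup_add lookup_sum lookup_single h_def inj_eq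
        image_set_diff[symmetric] sum.reindex[OF inj_on_subset[OF _ subset_UNIV]])
  have flip_iff: "flip_exp (h ` A) (h ` S) = t \<longleftrightarrow> flip_exp A S = t" for S
    using flip t surjD[OF \<open>surj \<rho>\<close>] by (metis poly_mapping_eqI)
  have "{S. S \<subseteq> h ` A \<and> flip_exp (h ` A) S = t} = image h ` {S. S \<subseteq> A \<and> flip_exp A S = t}"
    using flip_iff by (auto simp: subset_image_iff)
  then have "(\<Sum>S | S \<subseteq> h ` A \<and> flip_exp (h ` A) S = t. (- 1) ^ card S)
      = (\<Sum>S\<in>image h ` {S. S \<subseteq> A \<and> flip_exp A S = t}. (- 1) ^ card S :: real)"
    by simp
  also have "\<dots> = (\<Sum>S | S \<subseteq> A \<and> flip_exp A S = t. (- 1) ^ card S)"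
  proof (subst sum.reindex)
    show "inj_on (image h) {S. S \<subseteq> A \<and> flip_exp A S = t}"
      using \<open>inj h\<close> by (intro inj_onI) (simp add: inj_image_eq_iff)
    have "card (h ` S) = card S" for S
      using \<open>inj h\<close> by (intro card_image) (rule inj_on_subset, auto)
    then show "sum ((\<lambda>S. (- 1) ^ card S :: real) \<circ> image h) {S. S \<subseteq> A \<and> flip_exp A S = t}
        = (\<Sum>S | S \<subseteq> A \<and> flip_exp A S = t. (- 1) ^ card S)"
      by simp
  qed
  finally show ?thesis
    using \<open>finite A\<close> by (simp add: lookup_arc_prod h_def)
qed

section \<open>The toroidal grid\<close>

text \<open>The two directions are kept apart because the reflection will reverse only the
  first.\<close>

definition step_fst :: "nat \<Rightarrow> nat \<Rightarrow> ((nat \<times> nat) \<times> (nat \<times> nat)) set" where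
  "step_fst a b = {((i, j), (i', j')). i < a \<and> j < b \<and> i' = (i + 1) mod a \<and> j' = j}"

definition step_snd :: "nat \<Rightarrow> nat \<Rightarrow> ((nat \<times> nat) \<times> (nat \<times> nat)) set" where
  "step_snd a b = {((i, j), (i', j')). i < a \<and> j < b \<and> i' = i \<and> j' = (j + 1) mod b}"

lemma pverts_toroidal_grid: "pverts (toroidal_grid a b) = {..<a} \<times> {..<b}"
  by (simp add: toroidal_grid_def box_product_def cycle_graph_def)

lemma parcs_toroidal_grid:
  assumes "a > 0" "b > 0"
  shows "parcs (toroidal_grid a b) = step_fst a b \<union> step_snd a b \<union> (step_fst a b \<union> step_snd a b)\<inverse>"
  using assms
  by (auto simp: toroidal_grid_def box_product_def cycle_graph_def step_fst_def step_snd_def)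

lemma pair_graph_toroidal_grid: "a \<ge> 2 \<Longrightarrow> b \<ge> 2 \<Longrightarrow> pair_graph (toroidal_grid a b)"
  unfolding toroidal_grid_def by (intro pair_graph_box_product pair_graph_cycle_graph)

text \<open>With lengths at least 3, two steps never return to the start, so no step is the converse
  of another.\<close>

lemma orients_steps:
  assumes "a \<ge> 3" "b \<ge> 3"
  shows "orients (step_fst a b \<union> step_snd a b) (parcs (toroidal_grid a b))"
  using assms
  by (auto simp: orients_def parcs_toroidal_grid step_fst_def step_snd_def mod_Suc split: if_splits)

lemma step_fst_eq_image: "step_fst a b = (\<lambda>(i, j). ((i, j), ((i + 1) mod a, j))) ` ({..<a} \<times> {..<b})"
  by (auto simp: step_fst_def image_iff)

lemma step_snd_eq_image: "step_snd a b = (\<lambda>(i, j). ((i, j), (i, (j + 1) mod b))) ` ({..<a} \<times> {..<b})"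
  by (auto simp: step_snd_def image_iff)

lemma card_step_fst: "card (step_fst a b) = a * b"
  unfolding step_fst_eq_image by (subst card_image) (auto simp: inj_on_def)

lemma card_step_snd: "card (step_snd a b) = a * b"
  unfolding step_snd_eq_image by (subst card_image) (auto simp: inj_on_def)

lemma finite_step_fst: "finite (step_fst a b)"
  by (simp add: step_fst_eq_image)

lemma finite_step_snd: "finite (step_snd a b)"
  by (simp add: step_snd_eq_image)

section \<open>Lower bound: reflection of the first cycle\<close>

text \<open>Negation modulo \<open>a\<close> on the first coordinate, extended by the identity to a
  bijection of the whole type.\<close>

definition reflect :: "nat \<Rightarrow> nat \<times> nat \<Rightarrow> nat \<times> nat" where
  "reflect a = (\<lambda>(i, j). (if i = 0 \<or> i \<ge> a then i else a - i, j))"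

lemma reflect_reflect [simp]: "reflect a (reflect a v) = v"
  by (auto simp: reflect_def split: prod.splits)

lemma bij_reflect: "bij (reflect a)"
  by (rule o_bij[of "reflect a"]) (auto simp: fun_eq_iff)

lemma image_involution_eq:
  assumes "\<And>x. h (h x) = x" "h ` A \<subseteq> B" "h ` B \<subseteq> A"
  shows "h ` A = B"
  using assms by (metis image_subset_iff subsetI subset_antisym image_eqI)

text \<open>Negation turns a step from \<open>i\<close> to \<open>i + 1\<close> into one from
  \<open>-i\<close> to \<open>-i - 1\<close>.\<close>

lemma reflect_step_fst: "map_prod (reflect a) (reflect a) ` step_fst a b = (step_fst a b)\<inverse>"
  by (rule image_involution_eq)
    (auto simp: reflect_def step_fst_def mod_Suc split: if_splits)

lemma reflect_step_snd: "map_prod (reflect a) (reflect a) ` step_snd a b = step_snd a b"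
  by (rule image_involution_eq)
    (auto simp: reflect_def step_snd_def mod_Suc split: if_splits)

lemma not_choosable_odd_torus:
  assumes "a \<ge> 3" "b \<ge> 3" "odd a" "odd b" "k \<le> 3"
  shows "\<not> alon_tarsi_choosable (toroidal_grid a b) k"
proof
  define A where "A = step_fst a b \<union> step_snd a b"
  define V where "V = {..<a} \<times> {..<b}"
  have A: "orients A (parcs (toroidal_grid a b))"
    unfolding A_def using assms by (intro orients_steps)
  have "finite A"
    by (simp add: A_def finite_step_fst finite_step_snd)
  have disj: "step_fst a b \<inter> step_snd a b = {}" "(step_fst a b)\<inverse> \<inter> step_snd a b = {}"
    using assms by (auto simp: step_fst_def step_snd_def mod_Suc split: if_splits)
  have V: "finite V" "A \<subseteq> V \<times> V" "card V = a * b"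
    using assms by (auto simp: V_def A_def step_fst_def step_snd_def)
  have "card A = 2 * card V"
    unfolding A_def using disj
    by (subst card_Un_disjoint) (simp_all add: finite_step_fst finite_step_snd card_step_fst card_step_snd V)
  assume "alon_tarsi_choosable (toroidal_grid a b) k"
  then obtain t where t: "Poly_Mapping.lookup (arc_prod A) t \<noteq> 0"
    "\<And>v. v \<in> V \<Longrightarrow> Poly_Mapping.lookup t v < k"
    using alon_tarsi_choosable_orients[OF pair_graph_toroidal_grid A] assms
    by (auto simp: pverts_toroidal_grid V_def)
  from t(1) obtain S where S: "S \<subseteq> A" "flip_exp A S = t"
    using lookup_arc_prod[OF \<open>finite A\<close>, of t] by (metis (mono_tags, lifting) mem_Collect_eq sum.not_neutral_contains_not_neutral)
  have le2: "Poly_Mapping.lookup t v \<le> 2" if "v \<in> V" for v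
    using t(2)[OF that] \<open>k \<le> 3\<close> by simp
  have "(\<Sum>v\<in>V. Poly_Mapping.lookup t v) = card S + card (A - S)"
    using flip_exp_weighted_sum[OF V(1,2) S(1), of "\<lambda>_. 1"] S(2) by simp
  also have "\<dots> = card A"
    using card_Un_disjoint[of S "A - S"] S(1) \<open>finite A\<close> by (auto simp: Un_absorb1 finite_subset)
  finally have "(\<Sum>v\<in>V. Poly_Mapping.lookup t v) = (\<Sum>v\<in>V. 2)"
    using \<open>card A = 2 * card V\<close> by simp
  \<comment> \<open>Exponents bounded by 2 whose average is 2 all equal 2.\<close>
  then have "Poly_Mapping.lookup t v = 2" if "v \<in> V" for v
    using sum_mono_inv[of "Poly_Mapping.lookup t" V "\<lambda>_. 2"] le2 that V(1) by blast
  \<comment> \<open>Invariance of \<open>t\<close> is required on all pairs, also off the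
    grid.\<close>
  moreover have "Poly_Mapping.lookup t v = 0" if "v \<notin> V" for v
    using flip_exp_outside[OF V(2) S(1) that] S(2) by simp
  moreover have "reflect a v \<in> V \<longleftrightarrow> v \<in> V" for v
    by (auto simp: reflect_def V_def split: prod.splits if_splits)
  ultimately have "Poly_Mapping.lookup t (reflect a v) = Poly_Mapping.lookup t v" for v
    by (cases "v \<in> V") auto
  then have "Poly_Mapping.lookup (arc_prod A) t
      = Poly_Mapping.lookup (arc_prod (map_prod (reflect a) (reflect a) ` A)) t"
    using bij_reflect \<open>finite A\<close> by (intro lookup_arc_prod_image[symmetric])
  also have "map_prod (reflect a) (reflect a) ` A = (step_fst a b)\<inverse> \<union> step_snd a b"
    by (simp add: A_def image_Un reflect_step_fst reflect_step_snd)
  also have "arc_prod \<dots> = (- 1) ^ (a * b) * arc_prod A"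
    unfolding A_def using arc_prod_converse_union[OF finite_step_fst finite_step_snd disj]
    by (simp only: card_step_fst)
  \<comment> \<open>Here the oddness of \<open>a * b\<close> enters.\<close>
  also have "Poly_Mapping.lookup \<dots> t = - Poly_Mapping.lookup (arc_prod A) t"
    using assms by (simp add: lookup_minus_one_power_mult)
  finally show False
    using t(1) by simp
qed

section \<open>Upper bound: orientation along ranks\<close>

text \<open>
  The vertices of the 4-cycle on \<open>{0, 1} \<times> {0, 1}\<close> share the rank 0; all other ranks are positive
  and distinct.
\<close>

definition torus_rank :: "nat \<Rightarrow> nat \<times> nat \<Rightarrow> nat" where
  "torus_rank b = (\<lambda>(i, j). if i < 2 \<and> j < 2 then 0 else i * b + j)"

text \<open>An acyclic orientation would have a source, of out-degree 4; the directed cycle gives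
  every vertex of rank 0 an incoming arc.\<close>

definition square_cycle :: "((nat \<times> nat) \<times> (nat \<times> nat)) set" where
  "square_cycle = {((0, 0), (0, 1)), ((0, 1), (1, 1)), ((1, 1), (1, 0)), ((1, 0), (0, 0))}"

text \<open>Division by \<open>b\<close> recovers \<open>i\<close> from \<open>i * b + j\<close>,
  and position 0 itself lies in the square.\<close>

lemma torus_rank_eqD:
  assumes "torus_rank b (i, j) = torus_rank b (i', j')" "j < b" "j' < b"
  shows "(i, j) = (i', j') \<or> i < 2 \<and> j < 2 \<and> i' < 2 \<and> j' < 2"
proof (cases "i < 2 \<and> j < 2 \<or> i' < 2 \<and> j' < 2")
  case True
  then show ?thesis
    using assms by (auto simp: torus_rank_def split: if_splits)
next
  case False
  then have eq: "i * b + j = i' * b + j'"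
    using assms(1) by (auto simp: torus_rank_def)
  have "i = i'"
    using arg_cong[OF eq, of "\<lambda>x. x div b"] assms(2,3) by simp
  then show ?thesis
    using eq by simp
qed

text \<open>Adding \<open>k\<close> before subtracting 1 avoids truncation at
  \<open>i = 0\<close>.\<close>

lemma neighbours_cycle_graph:
  assumes "(i, j) \<in> parcs (cycle_graph k)"
  shows "j = (i + 1) mod k \<or> j = (i + k - 1) mod k"
proof (cases "i = (j + 1) mod k")
  case True
  moreover have "j < k"
    using assms by (simp add: cycle_graph_def)
  ultimately show ?thesis
    by (cases "j + 1 = k") auto
next
  case False
  then show ?thesis
    using assms by (auto simp: cycle_graph_def)
qed

lemma neighbours_toroidal_grid:
  assumes "((i, j), w) \<in> parcs (toroidal_grid a b)"
  shows "w \<in> {((i + 1) mod a, j), ((i + a - 1) mod a, j), (i, (j + 1) mod b), (i, (j + b - 1) mod b)}"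
  using assms by (auto simp: toroidal_grid_def box_product_def dest!: neighbours_cycle_graph)

lemma choosable_4_torus:
  assumes "a \<ge> 3" "b \<ge> 3"
  shows "alon_tarsi_choosable (toroidal_grid a b) 4"
proof -
  let ?R = "parcs (toroidal_grid a b)" and ?r = "torus_rank b"
  interpret pair_graph "toroidal_grid a b"
    using assms by (intro pair_graph_toroidal_grid) auto
  define A where "A = {(u, v) \<in> ?R. ?r u < ?r v} \<union> square_cycle"
  have sym: "(v, u) \<in> ?R" if "(u, v) \<in> ?R" for u v
    using that assms by (auto simp: parcs_toroidal_grid)
  have square: "square_cycle \<subseteq> ?R"
    using assms by (auto simp: square_cycle_def parcs_toroidal_grid step_fst_def step_snd_def)
  have level: "(u, v) \<in> square_cycle \<or> (v, u) \<in> square_cycle" if "(u, v) \<in> ?R" "?r u = ?r v" for u v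
  proof -
    obtain i j i' j' where uv: "u = (i, j)" "v = (i', j')"
      by force
    have "j < b" "j' < b" "u \<noteq> v"
      using that(1) pair_no_loops[OF that(1)] arc_fst_in_verts[OF that(1)] arc_snd_in_verts[OF that(1)]
      by (auto simp: pverts_toroidal_grid uv)
    then have small: "i < 2" "j < 2" "i' < 2" "j' < 2"
      using torus_rank_eqD[of b i j i' j'] that(2) by (auto simp: uv)
    \<comment> \<open>Lengths at least 3 exclude wrap-around between the coordinates 0 and
      1.\<close>
    then have "(i + 1) mod a = i + 1" "(i' + 1) mod a = i' + 1" "(j + 1) mod b = j + 1" "(j' + 1) mod b = j' + 1"
      using assms by simp_all
    then have "i' = i \<and> (j' = j + 1 \<or> j = j' + 1) \<or> j' = j \<and> (i' = i + 1 \<or> i = i' + 1)"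
      using that(1) assms by (auto simp: uv parcs_toroidal_grid step_fst_def step_snd_def)
    then show ?thesis
      using small by (auto simp: uv square_cycle_def less_2_cases_iff)
  qed
  have square_rank: "?r u = 0 \<and> ?r v = 0" if "(u, v) \<in> square_cycle" for u v
    using that by (auto simp: square_cycle_def torus_rank_def)
  have "A \<union> A\<inverse> = ?R"
  proof
    show "A \<union> A\<inverse> \<subseteq> ?R"
      using square sym by (auto simp: A_def)
    show "?R \<subseteq> A \<union> A\<inverse>"
    proof (rule subrelI)
      fix u v assume "(u, v) \<in> ?R"
      then show "(u, v) \<in> A \<union> A\<inverse>"
        using level[of u v] sym[of u v] by (cases "?r u" "?r v" rule: linorder_cases) (auto simp: A_def)
    qed
  qed
  moreover have "A \<inter> A\<inverse> = {}"
  proof -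
    have "square_cycle \<inter> square_cycle\<inverse> = {}"
      by (auto simp: square_cycle_def)
    then show ?thesis
      by (auto simp: A_def dest: square_rank)
  qed
  ultimately have A: "orients A ?R"
    by (simp add: orients_def)
  have "finite A"
    using \<open>A \<union> A\<inverse> = ?R\<close> pair_finite_arcs finite_subset[of A ?R] by auto
  have nonzero: "Poly_Mapping.lookup (arc_prod A) (flip_exp A {}) \<noteq> 0"
  \<comment> \<open>The checkerboard colouring may fail across wrap-around edges, but it is only
    needed on the square.\<close>
  proof (rule lookup_arc_prod_outdegrees_nonzero[where r = ?r and p = "\<lambda>(i, j). (i + j) mod 2"])
    show "?r u \<le> ?r v" if "(u, v) \<in> A" for u v
      using that by (auto simp: A_def dest: square_rank)
    show "(case u of (i, j) \<Rightarrow> (i + j) mod 2) + (case v of (i, j) \<Rightarrow> (i + j) mod 2) = 1"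
      if "(u, v) \<in> A" "?r u = ?r v" for u v
      using that by (auto simp: A_def square_cycle_def)
  qed fact
  have "Poly_Mapping.lookup (flip_exp A {}) v < 4" if v: "v \<in> pverts (toroidal_grid a b)" for v
  proof -
    obtain i j where ij: "v = (i, j)" "i < a" "j < b"
      using v by (auto simp: pverts_toroidal_grid)
    let ?N = "{((i + 1) mod a, j), ((i + a - 1) mod a, j), (i, (j + 1) mod b), (i, (j + b - 1) mod b)}"
    \<comment> \<open>Inside the square \<open>w\<close> is the cyclic predecessor. Elsewhere it is
      \<open>(0, j - 1)\<close> if \<open>i = 0\<close> and \<open>(i - 1, j)\<close> otherwise,
      whose rank is smaller.\<close>
    obtain w where w: "(w, v) \<in> A"
    proof (cases "i < 2 \<and> j < 2")
      case True
      then have "i \<in> {0, 1}" "j \<in> {0, 1}"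
        by auto
      then show ?thesis
        using that by (auto simp: A_def square_cycle_def ij)
    next
      case False
      show ?thesis
      proof (cases "i = 0")
        case True
        then have "((i, j - 1), v) \<in> A"
          using False ij assms
          by (auto simp: A_def parcs_toroidal_grid step_snd_def torus_rank_def)
        then show ?thesis
          by (rule that)
      next
        case i: False
        then have "i * b = (i - 1) * b + b"
          by (cases i) auto
        then have "((i - 1, j), v) \<in> A"
          using i False ij assms
          by (auto simp: A_def parcs_toroidal_grid step_fst_def torus_rank_def)
        then show ?thesis
          by (rule that)
      qed
    qed
    have N: "x \<in> ?N" if "(v, x) \<in> ?R" for x
      using neighbours_toroidal_grid that unfolding ij by blast
    have "w \<in> ?N"
      using w A by (intro N) (auto simp: orients_def)
    \<comment> \<open>The arc from \<open>w\<close> to \<open>v\<close> rules out its converse,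
      leaving at most three possible heads.\<close>
    have "{e \<in> A. fst e = v} \<subseteq> Pair v ` (?N - {w})"
    proof
      fix e assume e: "e \<in> {e \<in> A. fst e = v}"
      then obtain x where x: "e = (v, x)"
        by (cases e) auto
      then have "x \<in> ?N"
        using e A by (intro N) (auto simp: orients_def)
      moreover have "x \<noteq> w"
        using e x w A by (auto simp: orients_def)
      ultimately show "e \<in> Pair v ` (?N - {w})"
        using x by blast
    qed
    then have "card {e \<in> A. fst e = v} \<le> card (?N - {w})"
      by (intro order.trans[OF card_mono card_image_le]) auto
    also have "\<dots> < card ?N"
      using \<open>w \<in> ?N\<close> by (intro psubset_card_mono) auto
    also have "\<dots> \<le> 4"
      by (simp add: card_insert_if)
    finally show ?thesis
      using \<open>finite A\<close>
      by (simp add: flip_exp_def lookup_sum lookup_single when_def sum.If_cases Int_def)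
  qed
  then show ?thesis
    using alon_tarsi_choosable_orients[OF pair_graph_axioms A] nonzero by blast
qed

theorem mainTheorem6:
  fixes m n :: nat
  assumes "m \<ge> 1" and "n \<ge> 1"
  shows "alon_tarsi_number (toroidal_grid (2 * m + 1) (2 * n + 1)) = 4"
  unfolding alon_tarsi_number_def
proof (rule Least_equality)
  show "alon_tarsi_choosable (toroidal_grid (2 * m + 1) (2 * n + 1)) 4"
    using assms by (intro choosable_4_torus) auto
  show "4 \<le> k" if "alon_tarsi_choosable (toroidal_grid (2 * m + 1) (2 * n + 1)) k" for k
    using that not_choosable_odd_torus[of "2 * m + 1" "2 * n + 1" k] assms by force
qed

end
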